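(* Let $(L\xrightarrow{\delta}E\xrightarrow{\partial}G,\triangleright,\{\,,\,\})$ be a 2-crossed module with $E$ finite. Consider the crossed module $(\delta\colon L\to E,\triangleright')$, where $e\triangleright' l=l\,\{\delta(l)^{-1},e\}$. Put, for $A,B\in E$, $$\psi(A,B)=\{A,B\},\qquad \phi(A,B)=A\triangleright'\{A^{-1},B\}.$$ Then $\Phi=(\psi,\phi)$ is a framed Reidemeister pair for $(\delta\colon L\to E,\triangleright')$.
   Context: A 2-crossed module is a chain complex of groups $L\xrightarrow{\delta}E\xrightarrow{\partial}G$ with left actions $\triangleright$ of $G$ by automorphisms on $L$ and $E$ (and on $G$ by conjugation), and a map $\{\,,\,\}\colon E\times E\to L$ (Peiffer lifting) with $a\triangleright\{e,f\}=\{a\triangleright e,a\triangleright f\}$ for $a\in G$, such that: (i) $\delta,\partial$ are $G$-equivariant and $\partial\circ\delta=1$; (ii) $\delta(\{e,f\})=\langle e,f\rangle:=(efe^{-1})(\partial(e)\triangleright f^{-1})$; (iii) $[l,k]=\{\delta(l),\delta(k)\}$, where $[l,k]=lkl^{-1}k^{-1}$; (iv) $\{\delta(l),e\}\{e,\delta(l)\}=l\,(\partial(e)\triangleright l^{-1})$; (v) $\{ef,g\}=\{e,fgf^{-1}\}\,(\partial(e)\triangleright\{f,g\})$; (vi) $\{e,fg\}=\{e,f\}\,\big((\partial(e)\triangleright f)\triangleright'\{e,g\}\big)$, for all $e,f,g\in E$, $k,l\in L$, where $e\triangleright' l:=l\{\delta(l)^{-1},e\}$. It is known that $\triangleright'$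 is a left action of $E$ on $L$ by automorphisms making $(\delta\colon L\to E,\triangleright')$ a crossed module. For a crossed module $(\mu\colon P\to H,\cdot)$ (group morphism $\mu$ with left action of $H$ on $P$ by automorphisms, $\mu(g\cdot e)=g\mu(e)g^{-1}$, $\mu(e)\cdot f=efe^{-1}$), functions $\psi,\phi\colon H\times H\to P$ form a framed Reidemeister pair if for all $X,Y,T\in H$: (R2) $\phi(X,Y)\psi(X,Z)=1$, where $Z=X^{-1}\mu(\phi(X,Y))^{-1}YX$; (R3) $\phi(Y,X)(Y\cdot\phi(T,Z))\phi(T,Y)=(X\cdot\phi(T,Y))\phi(T,X)(T\cdot\phi(V,W))$, where $Z=Y^{-1}\mu(\phi(Y,X))^{-1}XY$, $V=T^{-1}\mu(\phi(T,Y))^{-1}YT$, $W=T^{-1}\mu(\phi(T,X))^{-1}XT$; and moreover (a) for each $Z\in H$ the equation $\mu(\phi(A,Z))A=Z$ has a unique solution $A=f(Z)\in H$; (b) with $g(A)=\mu(\psi(A,A))^{-1}A$ one has $f\circ g=g\circ f=\mathrm{id}_H$. *)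

theory Defs
  imports "HOL-Algebra.Bij"
begin

text \<open>
  A left action by automorphisms is a homomorphism into the library group \<^const>\<open>AutoGroup\<close>.
  Its elements are extensional functions (undefined off the carrier), and its product is
  composition restricted to the carrier; on the carrier this is the usual notion.
\<close>

locale crossed_module =
  hom: group_hom P H \<mu> + action: group_hom H "AutoGroup P" act
  for P :: "('p, 'r) monoid_scheme" and H :: "('h, 's) monoid_scheme"
    and \<mu> :: "'p \<Rightarrow> 'h" and act :: "'h \<Rightarrow> 'p \<Rightarrow> 'p" +
  assumes equivariant:
      "\<lbrakk>g \<in> carrier H; e \<in> carrier P\<rbrakk> \<Longrightarrow> \<mu> (act g e) = g \<otimes>\<^bsub>H\<^esub> \<mu> e \<otimes>\<^bsub>H\<^esub> inv\<^bsub>H\<^esub> g"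
    and peiffer:
      "\<lbrakk>e \<in> carrier P; f \<in> carrier P\<rbrakk> \<Longrightarrow> act (\<mu> e) f = e \<otimes>\<^bsub>P\<^esub> f \<otimes>\<^bsub>P\<^esub> inv\<^bsub>P\<^esub> e"

text \<open>
  The action \<open>e \<triangleright>' l = l {\<delta>(l)\<^sup>-\<^sup>1, e}\<close> of \<open>E\<close> on \<open>L\<close>, restricted to \<open>carrier L\<close> so that it can
  take values in \<^term>\<open>AutoGroup L\<close>.
\<close>

definition lifting_action ::
    "('l, 'x) monoid_scheme \<Rightarrow> ('e, 'y) monoid_scheme \<Rightarrow> ('l \<Rightarrow> 'e) \<Rightarrow> ('e \<Rightarrow> 'e \<Rightarrow> 'l) \<Rightarrow> 'e \<Rightarrow> 'l \<Rightarrow> 'l"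
  where "lifting_action L E \<delta> lift e = (\<lambda>l\<in>carrier L. l \<otimes>\<^bsub>L\<^esub> lift (inv\<^bsub>E\<^esub> (\<delta> l)) e)"

text \<open>
  \<open>actL\<close> and \<open>actE\<close> are the actions of \<open>G\<close> on \<open>L\<close> and \<open>E\<close>; the action of \<open>G\<close> on itself is by
  conjugation. \<open>bd\<close> is the boundary map \<open>\<partial>\<close>, and \<open>lift e f\<close> is the Peiffer lifting \<open>{e, f}\<close>.
\<close>

locale two_crossed_module =
  hom_\<delta>: group_hom L E \<delta> + hom_bd: group_hom E G bd +
  action_L: group_hom G "AutoGroup L" actL + action_E: group_hom G "AutoGroup E" actE
  for L :: "('l, 'x) monoid_scheme" and E :: "('e, 'y) monoid_scheme"
    and G :: "('g, 'z) monoid_scheme"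
    and \<delta> :: "'l \<Rightarrow> 'e" and bd :: "'e \<Rightarrow> 'g"
    and actL :: "'g \<Rightarrow> 'l \<Rightarrow> 'l" and actE :: "'g \<Rightarrow> 'e \<Rightarrow> 'e" +
  fixes lift :: "'e \<Rightarrow> 'e \<Rightarrow> 'l"
  assumes lift_closed: "lift \<in> carrier E \<rightarrow> carrier E \<rightarrow> carrier L"
    and lift_equivariant:
      "\<lbrakk>a \<in> carrier G; e \<in> carrier E; f \<in> carrier E\<rbrakk>
        \<Longrightarrow> actL a (lift e f) = lift (actE a e) (actE a f)"
    and \<delta>_equivariant:
      "\<lbrakk>a \<in> carrier G; l \<in> carrier L\<rbrakk> \<Longrightarrow> \<delta> (actL a l) = actE a (\<delta> l)"
    and bd_equivariant:
      "\<lbrakk>a \<in> carrier G; e \<in> carrier E\<rbrakk> \<Longrightarrow> bd (actE a e) = a \<otimes>\<^bsub>G\<^esub> bd e \<otimes>\<^bsub>G\<^esub> inv\<^bsub>G\<^esub> a"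
    and bd_\<delta>: "l \<in> carrier L \<Longrightarrow> bd (\<delta> l) = \<one>\<^bsub>G\<^esub>"
    and \<delta>_lift:
      "\<lbrakk>e \<in> carrier E; f \<in> carrier E\<rbrakk>
        \<Longrightarrow> \<delta> (lift e f) = (e \<otimes>\<^bsub>E\<^esub> f \<otimes>\<^bsub>E\<^esub> inv\<^bsub>E\<^esub> e) \<otimes>\<^bsub>E\<^esub> actE (bd e) (inv\<^bsub>E\<^esub> f)"
    and lift_\<delta>_\<delta>:
      "\<lbrakk>l \<in> carrier L; k \<in> carrier L\<rbrakk>
        \<Longrightarrow> l \<otimes>\<^bsub>L\<^esub> k \<otimes>\<^bsub>L\<^esub> inv\<^bsub>L\<^esub> l \<otimes>\<^bsub>L\<^esub> inv\<^bsub>L\<^esub> k = lift (\<delta> l) (\<delta> k)"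
    and lift_\<delta>:
      "\<lbrakk>l \<in> carrier L; e \<in> carrier E\<rbrakk>
        \<Longrightarrow> lift (\<delta> l) e \<otimes>\<^bsub>L\<^esub> lift e (\<delta> l) = l \<otimes>\<^bsub>L\<^esub> actL (bd e) (inv\<^bsub>L\<^esub> l)"
    and lift_mult_left:
      "\<lbrakk>e \<in> carrier E; f \<in> carrier E; g \<in> carrier E\<rbrakk>
        \<Longrightarrow> lift (e \<otimes>\<^bsub>E\<^esub> f) g = lift e (f \<otimes>\<^bsub>E\<^esub> g \<otimes>\<^bsub>E\<^esub> inv\<^bsub>E\<^esub> f) \<otimes>\<^bsub>L\<^esub> actL (bd e) (lift f g)"
    and lift_mult_right:
      "\<lbrakk>e \<in> carrier E; f \<in> carrier E; g \<in> carrier E\<rbrakk>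
        \<Longrightarrow> lift e (f \<otimes>\<^bsub>E\<^esub> g) =
            lift e f \<otimes>\<^bsub>L\<^esub> lifting_action L E \<delta> lift (actE (bd e) f) (lift e g)"

definition framing_f ::
    "('p, 'r) monoid_scheme \<Rightarrow> ('h, 's) monoid_scheme \<Rightarrow> ('p \<Rightarrow> 'h) \<Rightarrow> ('h \<Rightarrow> 'h \<Rightarrow> 'p) \<Rightarrow> 'h \<Rightarrow> 'h"
  where "framing_f P H \<mu> \<phi> Z = (THE A. A \<in> carrier H \<and> \<mu> (\<phi> A Z) \<otimes>\<^bsub>H\<^esub> A = Z)"

definition framing_g ::
    "('p, 'r) monoid_scheme \<Rightarrow> ('h, 's) monoid_scheme \<Rightarrow> ('p \<Rightarrow> 'h) \<Rightarrow> ('h \<Rightarrow> 'h \<Rightarrow> 'p) \<Rightarrow> 'h \<Rightarrow> 'h"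
  where "framing_g P H \<mu> \<psi> A = inv\<^bsub>H\<^esub> (\<mu> (\<psi> A A)) \<otimes>\<^bsub>H\<^esub> A"

locale framed_reidemeister_pair = crossed_module P H \<mu> act
  for P :: "('p, 'r) monoid_scheme" and H :: "('h, 's) monoid_scheme"
    and \<mu> :: "'p \<Rightarrow> 'h" and act :: "'h \<Rightarrow> 'p \<Rightarrow> 'p" +
  fixes \<psi> :: "'h \<Rightarrow> 'h \<Rightarrow> 'p" and \<phi> :: "'h \<Rightarrow> 'h \<Rightarrow> 'p"
  assumes psi_closed: "\<psi> \<in> carrier H \<rightarrow> carrier H \<rightarrow> carrier P"
    and phi_closed: "\<phi> \<in> carrier H \<rightarrow> carrier H \<rightarrow> carrier P"
    and R2:
      "\<lbrakk>X \<in> carrier H; Y \<in> carrier H;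
        Z = inv\<^bsub>H\<^esub> X \<otimes>\<^bsub>H\<^esub> inv\<^bsub>H\<^esub> (\<mu> (\<phi> X Y)) \<otimes>\<^bsub>H\<^esub> Y \<otimes>\<^bsub>H\<^esub> X\<rbrakk>
        \<Longrightarrow> \<phi> X Y \<otimes>\<^bsub>P\<^esub> \<psi> X Z = \<one>\<^bsub>P\<^esub>"
    and R3:
      "\<lbrakk>X \<in> carrier H; Y \<in> carrier H; T \<in> carrier H;
        Z = inv\<^bsub>H\<^esub> Y \<otimes>\<^bsub>H\<^esub> inv\<^bsub>H\<^esub> (\<mu> (\<phi> Y X)) \<otimes>\<^bsub>H\<^esub> X \<otimes>\<^bsub>H\<^esub> Y;
        V = inv\<^bsub>H\<^esub> T \<otimes>\<^bsub>H\<^esub> inv\<^bsub>H\<^esub> (\<mu> (\<phi> T Y)) \<otimes>\<^bsub>H\<^esub> Y \<otimes>\<^bsub>H\<^esub> T;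
        W = inv\<^bsub>H\<^esub> T \<otimes>\<^bsub>H\<^esub> inv\<^bsub>H\<^esub> (\<mu> (\<phi> T X)) \<otimes>\<^bsub>H\<^esub> X \<otimes>\<^bsub>H\<^esub> T\<rbrakk>
        \<Longrightarrow> \<phi> Y X \<otimes>\<^bsub>P\<^esub> act Y (\<phi> T Z) \<otimes>\<^bsub>P\<^esub> \<phi> T Y =
            act X (\<phi> T Y) \<otimes>\<^bsub>P\<^esub> \<phi> T X \<otimes>\<^bsub>P\<^esub> act T (\<phi> V W)"
    and unique_solution:
      "Z \<in> carrier H \<Longrightarrow> \<exists>!A. A \<in> carrier H \<and> \<mu> (\<phi> A Z) \<otimes>\<^bsub>H\<^esub> A = Z"
    and f_g: "A \<in> carrier H \<Longrightarrow> framing_f P H \<mu> \<phi> (framing_g P H \<mu> \<psi> A) = A"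
    and g_f: "A \<in> carrier H \<Longrightarrow> framing_g P H \<mu> \<psi> (framing_f P H \<mu> \<phi> A) = A"

end

theory Submission
  imports Defs
begin

text \<open>
  Write \<open>a \<rhd> x\<close> for the action of \<open>\<partial>(a)\<close>. Axiom (vi), applied to
  \<open>1 = {e, \<delta>(l) \<delta>(l)\<^sup>-\<^sup>1}\<close> and combined with (iv), turns the second action into \<open>e \<rhd>' l = {e, \<delta>(l)} (e \<rhd> l)\<close>.
  From this and (v), \<open>\<phi>(A, B) = {A, A\<^sup>-\<^sup>1 \<rhd> B}\<^sup>-\<^sup>1\<close> and \<open>A\<^sup>-\<^sup>1 \<delta>(\<phi>(A, B))\<^sup>-\<^sup>1 B A = A\<^sup>-\<^sup>1 \<rhd> B\<close>, which is (R2).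
  Putting \<open>Y = T \<rhd> V\<close> and \<open>X = T \<rhd> (V \<rhd> U)\<close>, the inverse of (R3) becomes
  \<open>{T, V U} (T \<rhd> {V, U}) = (T \<rhd>' {V, U}) {T, (V \<rhd> U) V}\<close>, and this is (vi) for
  \<open>V U = \<delta>{V, U} (V \<rhd> U) V\<close>. Finally \<open>\<delta>(\<phi>(A, Z)) A = Z\<close> just says \<open>A \<rhd> A = Z\<close>; since
  \<open>\<partial>(A \<rhd> A) = \<partial>(A)\<close>, its only solution is \<open>A = Z\<^sup>-\<^sup>1 \<rhd> Z\<close>, and \<open>g(A) = A \<rhd> A\<close>.
\<close>

section \<open>Group cancellation, and actions as homomorphisms into
  \<open>AutoGroup\<close>\<close>

lemma (in group) inv_mult_cancel_left [simp]:
  "\<lbrakk>x \<in> carrier G; y \<in> carrier G\<rbrakk> \<Longrightarrow> inv x \<otimes> (x \<otimes> y) = y"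
  "\<lbrakk>x \<in> carrier G; y \<in> carrier G\<rbrakk> \<Longrightarrow> x \<otimes> (inv x \<otimes> y) = y"
  by (simp_all flip: m_assoc)

lemma AutoGroup_action:
  assumes "group_hom G (AutoGroup P) act"
  shows AutoGroup_action_closed: "\<lbrakk>a \<in> carrier G; x \<in> carrier P\<rbrakk> \<Longrightarrow> act a x \<in> carrier P"
    and AutoGroup_action_mult: "\<lbrakk>a \<in> carrier G; x \<in> carrier P; y \<in> carrier P\<rbrakk>
      \<Longrightarrow> act a (x \<otimes>\<^bsub>P\<^esub> y) = act a x \<otimes>\<^bsub>P\<^esub> act a y"
    and AutoGroup_action_comp: "\<lbrakk>a \<in> carrier G; b \<in> carrier G; x \<in> carrier P\<rbrakk>
      \<Longrightarrow> act (a \<otimes>\<^bsub>G\<^esub> b) x = act a (act b x)"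
    and AutoGroup_action_one: "x \<in> carrier P \<Longrightarrow> act \<one>\<^bsub>G\<^esub> x = x"
proof -
  interpret group_hom G "AutoGroup P" act by fact
  have auto: "act b \<in> auto P" if "b \<in> carrier G" for b
    using hom_closed[OF that] by (simp add: AutoGroup_def)
  then have Bij: "act b \<in> Bij (carrier P)" if "b \<in> carrier G" for b
    using that by (simp add: auto_def)
  show "\<lbrakk>a \<in> carrier G; x \<in> carrier P\<rbrakk> \<Longrightarrow> act a x \<in> carrier P"
    and "\<lbrakk>a \<in> carrier G; x \<in> carrier P; y \<in> carrier P\<rbrakk>
      \<Longrightarrow> act a (x \<otimes>\<^bsub>P\<^esub> y) = act a x \<otimes>\<^bsub>P\<^esub> act a y"
    using auto by (auto simp: auto_def hom_def)
  show "act (a \<otimes>\<^bsub>G\<^esub> b) x = act a (act b x)"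
    if "a \<in> carrier G" "b \<in> carrier G" "x \<in> carrier P"
    using hom_mult[OF that(1,2)] that Bij
    by (simp add: AutoGroup_def BijGroup_def compose_def)
  show "x \<in> carrier P \<Longrightarrow> act \<one>\<^bsub>G\<^esub> x = x"
    using hom_one by (simp add: AutoGroup_def BijGroup_def)
qed

text \<open>Bijectivity of \<open>act a\<close> comes for free: \<open>comp\<close> and
  \<open>one\<close> make \<open>act (inv a)\<close> its two-sided inverse on the carrier.\<close>

lemma AutoGroup_homI:
  assumes "group G" and "group P"
    and ext: "\<And>a. a \<in> carrier G \<Longrightarrow> act a \<in> extensional (carrier P)"
    and closed: "\<And>a x. \<lbrakk>a \<in> carrier G; x \<in> carrier P\<rbrakk> \<Longrightarrow> act a x \<in> carrier P"
    and mult: "\<And>a x y. \<lbrakk>a \<in> carrier G; x \<in> carrier P; y \<in> carrier P\<rbrakk>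
      \<Longrightarrow> act a (x \<otimes>\<^bsub>P\<^esub> y) = act a x \<otimes>\<^bsub>P\<^esub> act a y"
    and comp: "\<And>a b x. \<lbrakk>a \<in> carrier G; b \<in> carrier G; x \<in> carrier P\<rbrakk>
      \<Longrightarrow> act (a \<otimes>\<^bsub>G\<^esub> b) x = act a (act b x)"
    and one: "\<And>x. x \<in> carrier P \<Longrightarrow> act \<one>\<^bsub>G\<^esub> x = x"
  shows "group_hom G (AutoGroup P) act"
proof -
  interpret G: group G by fact
  interpret P: group P by fact
  have inv: "act (inv\<^bsub>G\<^esub> a) (act a x) = x" "act a (act (inv\<^bsub>G\<^esub> a) x) = x"
    if "a \<in> carrier G" "x \<in> carrier P" for a x
    using that by (simp_all add: one flip: comp)
  have Bij: "act a \<in> Bij (carrier P)" if "a \<in> carrier G" for a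
  proof -
    have "bij_betw (act a) (carrier P) (carrier P)"
      by (rule bij_betw_byWitness[where f' = "act (inv\<^bsub>G\<^esub> a)"]) (auto simp: that inv closed)
    with ext[OF that] show ?thesis by (simp add: Bij_def)
  qed
  have "act \<in> hom G (AutoGroup P)"
  proof (rule homI)
    show "act a \<in> carrier (AutoGroup P)" if "a \<in> carrier G" for a
      using that Bij by (auto simp: AutoGroup_def auto_def hom_def closed mult)
    show "act (a \<otimes>\<^bsub>G\<^esub> b) = act a \<otimes>\<^bsub>AutoGroup P\<^esub> act b"
      if "a \<in> carrier G" "b \<in> carrier G" for a b
    \<comment> \<open>Both sides are extensional, so agreement on the carrier, which is
      \<open>comp\<close>, suffices.\<close>
    proof (rule extensionalityI[where A = "carrier P"])
      show "act (a \<otimes>\<^bsub>G\<^esub> b) \<in> extensional (carrier P)" using that by (simp add: ext)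
    qed (use that Bij in \<open>simp_all add: AutoGroup_def BijGroup_def compose_def comp\<close>)
  qed
  then show ?thesis
    by (simp add: group_hom_def group_hom_axioms_def P.AutoGroup \<open>group G\<close>)
qed

section \<open>Boundary actions and first rules for the Peiffer lifting\<close>

context two_crossed_module
begin

abbreviation boundary_act_E (infixr "\<rhd>\<^sub>E" 75) where "e \<rhd>\<^sub>E f \<equiv> actE (bd e) f"
abbreviation boundary_act_L (infixr "\<rhd>\<^sub>L" 75) where "e \<rhd>\<^sub>L l \<equiv> actL (bd e) l"
abbreviation lifting_act (infixr "\<rhd>''" 75) where "e \<rhd>' l \<equiv> lifting_action L E \<delta> lift e l"

lemmas L_assoc = hom_\<delta>.G.m_assoc
lemmas E_assoc = hom_\<delta>.H.m_assoc

lemma lift_in_carrier [simp]: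
  "\<lbrakk>e \<in> carrier E; f \<in> carrier E\<rbrakk> \<Longrightarrow> lift e f \<in> carrier L"
  using lift_closed by blast

lemmas actL_simps [simp] =
  AutoGroup_action_closed[OF action_L.group_hom_axioms]
  AutoGroup_action_mult[OF action_L.group_hom_axioms]
  AutoGroup_action_one[OF action_L.group_hom_axioms]

lemmas actE_simps [simp] =
  AutoGroup_action_closed[OF action_E.group_hom_axioms]
  AutoGroup_action_mult[OF action_E.group_hom_axioms]
  AutoGroup_action_one[OF action_E.group_hom_axioms]

lemmas actE_comp = AutoGroup_action_comp[OF action_E.group_hom_axioms]

text \<open>Elements act by the pointwise rules rather than by products in \<open>AutoGroup\<close>,
  and \<open>bd (inv e)\<close> stays unexpanded so that \<open>inv e \<rhd>\<^sub>E x\<close> keeps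
  the shape of the cancellation rules.\<close>

declare action_L.hom_mult [simp del] action_L.hom_one [simp del] action_L.hom_inv [simp del]
  action_E.hom_mult [simp del] action_E.hom_one [simp del] action_E.hom_inv [simp del]
  hom_bd.hom_inv [simp del]

lemma bd_inv_\<delta> [simp]: "l \<in> carrier L \<Longrightarrow> bd (inv\<^bsub>E\<^esub> (\<delta> l)) = \<one>\<^bsub>G\<^esub>"
  by (simp add: bd_\<delta> hom_bd.hom_inv)

lemma boundary_act_mult:
  "\<lbrakk>e \<in> carrier E; f \<in> carrier E; x \<in> carrier E\<rbrakk> \<Longrightarrow> (e \<otimes>\<^bsub>E\<^esub> f) \<rhd>\<^sub>E x = e \<rhd>\<^sub>E f \<rhd>\<^sub>E x"
  by (simp add: actE_comp)

lemma boundary_act_inv_cancel [simp]: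
  "\<lbrakk>e \<in> carrier E; x \<in> carrier E\<rbrakk> \<Longrightarrow> inv\<^bsub>E\<^esub> e \<rhd>\<^sub>E e \<rhd>\<^sub>E x = x"
  "\<lbrakk>e \<in> carrier E; x \<in> carrier E\<rbrakk> \<Longrightarrow> e \<rhd>\<^sub>E inv\<^bsub>E\<^esub> e \<rhd>\<^sub>E x = x"
  by (simp_all flip: boundary_act_mult)

lemma boundary_act_E_inv:
  assumes "e \<in> carrier E" "x \<in> carrier E" shows "e \<rhd>\<^sub>E inv\<^bsub>E\<^esub> x = inv\<^bsub>E\<^esub> (e \<rhd>\<^sub>E x)"
proof -
  have "e \<rhd>\<^sub>E \<one>\<^bsub>E\<^esub> = \<one>\<^bsub>E\<^esub>"
    using assms actE_simps(2)[of "bd e" "\<one>\<^bsub>E\<^esub>" "\<one>\<^bsub>E\<^esub>"] by (simp del: actE_simps(2))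
  then have "e \<rhd>\<^sub>E inv\<^bsub>E\<^esub> x \<otimes>\<^bsub>E\<^esub> e \<rhd>\<^sub>E x = \<one>\<^bsub>E\<^esub>"
    using assms by (simp flip: actE_simps(2))
  then show ?thesis using assms by (simp add: hom_\<delta>.H.inv_equality)
qed

lemma lifting_act_eq:
  "l \<in> carrier L \<Longrightarrow> e \<rhd>' l = l \<otimes>\<^bsub>L\<^esub> lift (inv\<^bsub>E\<^esub> (\<delta> l)) e"
  by (simp add: lifting_action_def)

lemma lifting_act_closed [simp]:
  "\<lbrakk>e \<in> carrier E; l \<in> carrier L\<rbrakk> \<Longrightarrow> e \<rhd>' l \<in> carrier L"
  by (simp add: lifting_act_eq)

text \<open>By (iii), \<open>k {inv (\<delta> k), \<delta> l}\<close> is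
  \<open>k [inv k, l]\<close>.\<close>

lemma lifting_act_peiffer:
  assumes "l \<in> carrier L" "k \<in> carrier L"
  shows "\<delta> l \<rhd>' k = l \<otimes>\<^bsub>L\<^esub> k \<otimes>\<^bsub>L\<^esub> inv\<^bsub>L\<^esub> l"
  using assms by (simp add: lifting_act_eq L_assoc flip: hom_\<delta>.hom_inv lift_\<delta>_\<delta>)

lemma \<delta>_lifting_act:
  assumes "e \<in> carrier E" "l \<in> carrier L"
  shows "\<delta> (e \<rhd>' l) = e \<otimes>\<^bsub>E\<^esub> \<delta> l \<otimes>\<^bsub>E\<^esub> inv\<^bsub>E\<^esub> e"
  using assms by (simp add: lifting_act_eq \<delta>_lift bd_\<delta> E_assoc)

lemma \<delta>_lift_eq:
  assumes "e \<in> carrier E" "f \<in> carrier E"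
  shows "\<delta> (lift e f) = e \<otimes>\<^bsub>E\<^esub> f \<otimes>\<^bsub>E\<^esub> inv\<^bsub>E\<^esub> e \<otimes>\<^bsub>E\<^esub> inv\<^bsub>E\<^esub> (e \<rhd>\<^sub>E f)"
  using assms by (simp add: \<delta>_lift boundary_act_E_inv)

text \<open>In (vi) the factor \<open>e \<rhd> \<delta> l\<close> equals
  \<open>\<delta> (e \<rhd> l)\<close> by equivariance, and such an element acts by
  conjugation.\<close>

lemma lift_\<delta>_mult_right:
  assumes "e \<in> carrier E" "l \<in> carrier L" "g \<in> carrier E"
  shows "lift e (\<delta> l \<otimes>\<^bsub>E\<^esub> g) = lift e (\<delta> l) \<otimes>\<^bsub>L\<^esub> e \<rhd>\<^sub>L l \<otimes>\<^bsub>L\<^esub> lift e g \<otimes>\<^bsub>L\<^esub> inv\<^bsub>L\<^esub> (e \<rhd>\<^sub>L l)"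
  using assms
  by (simp add: lift_mult_right L_assoc lifting_act_peiffer flip: \<delta>_equivariant)

lemma lift_one_left [simp]:
  assumes "e \<in> carrier E" shows "lift \<one>\<^bsub>E\<^esub> e = \<one>\<^bsub>L\<^esub>"
  using lift_mult_left[of "\<one>\<^bsub>E\<^esub>" "\<one>\<^bsub>E\<^esub>" e] assms by simp

text \<open>Axiom (vi) for \<open>e\<close>, \<open>1\<close>, \<open>1\<close> only gives \<open>1 \<rhd>' {e, 1} = 1\<close>, that is, \<open>{e, 1} {1, 1} = 1\<close>.\<close>
lemma lift_one_right [simp]:
  assumes "e \<in> carrier E" shows "lift e \<one>\<^bsub>E\<^esub> = \<one>\<^bsub>L\<^esub>"
proof -
  have "e \<rhd>\<^sub>E \<one>\<^bsub>E\<^esub> = \<one>\<^bsub>E\<^esub>"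
    using assms boundary_act_E_inv[of e "\<one>\<^bsub>E\<^esub>"] actE_simps(2)[of "bd e" "\<one>\<^bsub>E\<^esub>" "\<one>\<^bsub>E\<^esub>"]
    by (simp del: actE_simps(2))
  then have "\<one>\<^bsub>E\<^esub> \<rhd>' lift e \<one>\<^bsub>E\<^esub> = \<one>\<^bsub>L\<^esub>" and "\<delta> (lift e \<one>\<^bsub>E\<^esub>) = \<one>\<^bsub>E\<^esub>"
    using lift_mult_right[of e "\<one>\<^bsub>E\<^esub>" "\<one>\<^bsub>E\<^esub>"] assms by (simp_all add: \<delta>_lift_eq)
  then show ?thesis using assms by (simp add: lifting_act_eq)
qed

section \<open>The crossed module given by the second action\<close>

text \<open>Axiom (v) splits \<open>{inv (\<delta> k) inv (\<delta> l), e}\<close> into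
  \<open>{inv (\<delta> k), \<delta> x e} x\<close>; opening the first factor by the rule for
  \<open>\<delta> x e\<close> leaves \<open>inv k x k {inv (\<delta> k), e}\<close>, and
  \<open>l k\<close> on the left completes both actions.\<close>

lemma lifting_act_mult:
  assumes [simp]: "e \<in> carrier E" "l \<in> carrier L" "k \<in> carrier L"
  shows "e \<rhd>' (l \<otimes>\<^bsub>L\<^esub> k) = e \<rhd>' l \<otimes>\<^bsub>L\<^esub> e \<rhd>' k"
proof -
  define x where "x = lift (inv\<^bsub>E\<^esub> (\<delta> l)) e"
  have [simp]: "x \<in> carrier L" by (simp add: x_def)
  \<comment> \<open>This is (ii) for \<open>x\<close>; the boundary of
    \<open>inv (\<delta> l)\<close> is trivial, so \<open>e\<close> is not moved.\<close>
  have conj: "inv\<^bsub>E\<^esub> (\<delta> l) \<otimes>\<^bsub>E\<^esub> e \<otimes>\<^bsub>E\<^esub> \<delta> l = \<delta> x \<otimes>\<^bsub>E\<^esub> e"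
    by (simp add: x_def \<delta>_lift bd_\<delta> E_assoc)
  have "lift (inv\<^bsub>E\<^esub> (\<delta> k) \<otimes>\<^bsub>E\<^esub> inv\<^bsub>E\<^esub> (\<delta> l)) e = lift (\<delta> (inv\<^bsub>L\<^esub> k)) (\<delta> x \<otimes>\<^bsub>E\<^esub> e) \<otimes>\<^bsub>L\<^esub> x"
    by (subst lift_mult_left) (simp_all add: conj bd_\<delta> flip: x_def)
  also have "\<dots> = inv\<^bsub>L\<^esub> k \<otimes>\<^bsub>L\<^esub> x \<otimes>\<^bsub>L\<^esub> k \<otimes>\<^bsub>L\<^esub> lift (inv\<^bsub>E\<^esub> (\<delta> k)) e"
    by (subst lift_\<delta>_mult_right)
      (simp_all add: bd_\<delta> L_assoc flip: lift_\<delta>_\<delta> hom_\<delta>.hom_inv)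
  finally show ?thesis
    by (simp add: lifting_act_eq L_assoc hom_\<delta>.H.inv_mult_group flip: x_def)
qed

text \<open>Axiom (vi) with first argument \<open>inv (\<delta> l)\<close>, which has trivial
  boundary; multiplicativity then regroups the two factors.\<close>

lemma lifting_act_comp:
  assumes [simp]: "e \<in> carrier E" "f \<in> carrier E" "l \<in> carrier L"
  shows "(e \<otimes>\<^bsub>E\<^esub> f) \<rhd>' l = e \<rhd>' f \<rhd>' l"
proof -
  have "(e \<otimes>\<^bsub>E\<^esub> f) \<rhd>' l = e \<rhd>' l \<otimes>\<^bsub>L\<^esub> e \<rhd>' lift (inv\<^bsub>E\<^esub> (\<delta> l)) f"
    by (simp add: lifting_act_eq[of l] lift_mult_right bd_\<delta> L_assoc)
  also have "\<dots> = e \<rhd>' f \<rhd>' l"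
    by (subst lifting_act_mult[symmetric]) (simp_all add: lifting_act_eq[of l])
  finally show ?thesis .
qed

lemma crossed_module_lifting_action: "crossed_module L E \<delta> (lifting_action L E \<delta> lift)"
proof -
  have "group_hom E (AutoGroup L) (lifting_action L E \<delta> lift)"
    by (rule AutoGroup_homI)
      \<comment> \<open>The unit law is \<open>{inv (\<delta> l), 1} = 1\<close>; extensionality
        comes from the restriction in the definition of the action.\<close>
      (simp_all add: lifting_act_mult lifting_act_comp lifting_act_eq[of _ "\<one>\<^bsub>E\<^esub>"],
       simp add: lifting_action_def)
  then show ?thesis
    by (simp add: crossed_module_def crossed_module_axioms_def hom_\<delta>.group_hom_axioms
        \<delta>_lifting_act lifting_act_peiffer)
qed

section \<open>The second action and \<open>\<phi>\<close> in terms of liftings\<close>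

lemma lifting_act_eq_lift_mult:
  assumes [simp]: "e \<in> carrier E" "l \<in> carrier L"
  shows "e \<rhd>' l = lift e (\<delta> l) \<otimes>\<^bsub>L\<^esub> e \<rhd>\<^sub>L l"
proof -
  define p q where "p = lift e (\<delta> l)" and "q = lift e (inv\<^bsub>E\<^esub> (\<delta> l))"
  define m where "m = e \<rhd>\<^sub>L l"
  have [simp]: "p \<in> carrier L" "q \<in> carrier L" "m \<in> carrier L"
    by (simp_all add: p_def q_def m_def)
  have "\<one>\<^bsub>L\<^esub> = p \<otimes>\<^bsub>L\<^esub> m \<otimes>\<^bsub>L\<^esub> q \<otimes>\<^bsub>L\<^esub> inv\<^bsub>L\<^esub> m"
    using lift_\<delta>_mult_right[of e l "inv\<^bsub>E\<^esub> (\<delta> l)"] by (simp add: p_def q_def m_def)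
  then have 1: "p \<otimes>\<^bsub>L\<^esub> m \<otimes>\<^bsub>L\<^esub> q = m"
    using hom_\<delta>.G.inv_solve_right[of "\<one>\<^bsub>L\<^esub>" "p \<otimes>\<^bsub>L\<^esub> m \<otimes>\<^bsub>L\<^esub> q" m] by simp
  \<comment> \<open>Axiom (iv) for \<open>inv l\<close>, multiplied on the left by \<open>l\<close>.
    Comparing with the first equation, \<open>q\<close> cancels on the right.\<close>
  have 2: "e \<rhd>' l \<otimes>\<^bsub>L\<^esub> q = m"
    using lift_\<delta>[of "inv\<^bsub>L\<^esub> l" e] by (simp add: lifting_act_eq L_assoc q_def m_def)
  show ?thesis
    using hom_\<delta>.G.right_cancel[of q "e \<rhd>' l" "p \<otimes>\<^bsub>L\<^esub> m"] 1 2 by (simp add: p_def m_def)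
qed

text \<open>Removes the second action from \<open>\<phi>\<close>. Axiom (v) for
  \<open>A (inv A) = 1\<close> gives \<open>{A, C} (A \<rhd> l) = 1\<close>, where
  \<open>C = \<delta> l Z\<close>; expanding \<open>{A, \<delta> l Z}\<close> produces
  \<open>A \<rhd>' l\<close> and a conjugating factor that cancels.\<close>

lemma lifting_act_lift_inv:
  assumes [simp]: "A \<in> carrier E" "B \<in> carrier E"
  shows "A \<rhd>' lift (inv\<^bsub>E\<^esub> A) B = inv\<^bsub>L\<^esub> (lift A (inv\<^bsub>E\<^esub> A \<rhd>\<^sub>E B))"
proof -
  define l where "l = lift (inv\<^bsub>E\<^esub> A) B"
  define C where "C = inv\<^bsub>E\<^esub> A \<otimes>\<^bsub>E\<^esub> B \<otimes>\<^bsub>E\<^esub> A"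
  define Z where "Z = inv\<^bsub>E\<^esub> A \<rhd>\<^sub>E B"
  have [simp]: "l \<in> carrier L" "C \<in> carrier E" "Z \<in> carrier E"
    by (simp_all add: l_def C_def Z_def)
  have "\<delta> l = C \<otimes>\<^bsub>E\<^esub> inv\<^bsub>E\<^esub> Z"
    by (simp add: l_def C_def Z_def \<delta>_lift_eq)
  then have C: "\<delta> l \<otimes>\<^bsub>E\<^esub> Z = C" by (simp add: E_assoc)
  have AC: "lift A C \<otimes>\<^bsub>L\<^esub> A \<rhd>\<^sub>L l = \<one>\<^bsub>L\<^esub>"
    using lift_mult_left[of A "inv\<^bsub>E\<^esub> A" B] by (simp add: l_def C_def)
  have "lift A C = A \<rhd>' l \<otimes>\<^bsub>L\<^esub> lift A Z \<otimes>\<^bsub>L\<^esub> inv\<^bsub>L\<^esub> (A \<rhd>\<^sub>L l)"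
    using lift_\<delta>_mult_right[of A l Z] by (simp add: C lifting_act_eq_lift_mult)
  with AC have "A \<rhd>' l \<otimes>\<^bsub>L\<^esub> lift A Z = \<one>\<^bsub>L\<^esub>" by (simp add: L_assoc)
  then have "A \<rhd>' l = inv\<^bsub>L\<^esub> (lift A Z)" by (simp add: hom_\<delta>.G.inv_equality)
  then show ?thesis by (simp add: l_def Z_def)
qed

lemma \<delta>_lift_inv_boundary_act:
  assumes [simp]: "A \<in> carrier E" "B \<in> carrier E"
  shows "\<delta> (lift A (inv\<^bsub>E\<^esub> A \<rhd>\<^sub>E B)) = A \<otimes>\<^bsub>E\<^esub> inv\<^bsub>E\<^esub> A \<rhd>\<^sub>E B \<otimes>\<^bsub>E\<^esub> inv\<^bsub>E\<^esub> A \<otimes>\<^bsub>E\<^esub> inv\<^bsub>E\<^esub> B"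
  by (simp add: \<delta>_lift_eq)

section \<open>The third Reidemeister relation\<close>

text \<open>Both sides are \<open>{T, V U} (T \<rhd> {V, U})\<close>: the left by (vi) directly, the
  right after rewriting \<open>V U\<close> as \<open>\<delta> {V, U} (V \<rhd> U) V\<close>.\<close>

lemma lift_braid:
  assumes [simp]: "T \<in> carrier E" "V \<in> carrier E" "U \<in> carrier E"
  shows "lift T V \<otimes>\<^bsub>L\<^esub> (T \<rhd>\<^sub>E V) \<rhd>' lift T U \<otimes>\<^bsub>L\<^esub> T \<rhd>\<^sub>L lift V U =
    T \<rhd>' lift V U \<otimes>\<^bsub>L\<^esub> lift T (V \<rhd>\<^sub>E U) \<otimes>\<^bsub>L\<^esub> (T \<rhd>\<^sub>E V \<rhd>\<^sub>E U) \<rhd>' lift T V"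
proof -
  define l where "l = lift V U"
  define W where "W = V \<rhd>\<^sub>E U"
  have [simp]: "l \<in> carrier L" "W \<in> carrier E" by (simp_all add: l_def W_def)
  have VU: "V \<otimes>\<^bsub>E\<^esub> U = \<delta> l \<otimes>\<^bsub>E\<^esub> (W \<otimes>\<^bsub>E\<^esub> V)"
    by (simp add: l_def W_def \<delta>_lift_eq E_assoc)
  have "lift T V \<otimes>\<^bsub>L\<^esub> (T \<rhd>\<^sub>E V) \<rhd>' lift T U \<otimes>\<^bsub>L\<^esub> T \<rhd>\<^sub>L l = lift T (V \<otimes>\<^bsub>E\<^esub> U) \<otimes>\<^bsub>L\<^esub> T \<rhd>\<^sub>L l"
    by (simp add: lift_mult_right)
  \<comment> \<open>The trailing \<open>inv (T \<rhd> l)\<close> from the rule for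
    \<open>\<delta> l (W V)\<close> cancels the last factor; the front forms
    \<open>T \<rhd>' l\<close>.\<close>
  also have "\<dots> = T \<rhd>' l \<otimes>\<^bsub>L\<^esub> lift T (W \<otimes>\<^bsub>E\<^esub> V)"
    by (simp add: VU lift_\<delta>_mult_right lifting_act_eq_lift_mult L_assoc)
  also have "\<dots> = T \<rhd>' l \<otimes>\<^bsub>L\<^esub> lift T W \<otimes>\<^bsub>L\<^esub> (T \<rhd>\<^sub>E W) \<rhd>' lift T V"
    by (simp add: lift_mult_right L_assoc)
  finally show ?thesis by (simp add: l_def W_def)
qed

text \<open>This is (R3) with both sides inverted, every \<open>\<phi>\<close> being an inverse
  lifting; hence the reversed order of factors.\<close>

lemma lift_R3:
  assumes [simp]: "T \<in> carrier E" "X \<in> carrier E" "Y \<in> carrier E"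
  defines "Z \<equiv> inv\<^bsub>E\<^esub> Y \<rhd>\<^sub>E X" and "V \<equiv> inv\<^bsub>E\<^esub> T \<rhd>\<^sub>E Y" and "W \<equiv> inv\<^bsub>E\<^esub> T \<rhd>\<^sub>E X"
  shows "lift T V \<otimes>\<^bsub>L\<^esub> Y \<rhd>' lift T (inv\<^bsub>E\<^esub> T \<rhd>\<^sub>E Z) \<otimes>\<^bsub>L\<^esub> lift Y Z =
    T \<rhd>' lift V (inv\<^bsub>E\<^esub> V \<rhd>\<^sub>E W) \<otimes>\<^bsub>L\<^esub> lift T W \<otimes>\<^bsub>L\<^esub> X \<rhd>' lift T V"
proof -
  define U where "U = inv\<^bsub>E\<^esub> T \<rhd>\<^sub>E Z"
  have [simp]: "Z \<in> carrier E" "V \<in> carrier E" "W \<in> carrier E" "U \<in> carrier E"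
    by (simp_all add: Z_def V_def W_def U_def)
  have Y: "Y = T \<rhd>\<^sub>E V" and X: "X = T \<rhd>\<^sub>E W" and TU: "T \<rhd>\<^sub>E U = Z" and YZ: "Y \<rhd>\<^sub>E Z = X"
    by (simp_all add: Z_def V_def W_def U_def)
  \<comment> \<open>Equivariance makes \<open>V\<close> act as \<open>inv T Y T\<close>, so it sends
    \<open>U\<close> through \<open>Z\<close> and \<open>X\<close> to \<open>W\<close>.\<close>
  have "bd V = bd (inv\<^bsub>E\<^esub> T \<otimes>\<^bsub>E\<^esub> Y \<otimes>\<^bsub>E\<^esub> T)" by (simp add: V_def bd_equivariant hom_bd.hom_inv)
  then have VU: "V \<rhd>\<^sub>E U = W"
    by (simp add: boundary_act_mult TU YZ W_def del: hom_bd.hom_mult)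
  then have "inv\<^bsub>E\<^esub> V \<rhd>\<^sub>E W = U"
    using boundary_act_inv_cancel(1)[of V U] by (simp del: boundary_act_inv_cancel)
  moreover have "T \<rhd>\<^sub>L lift V U = lift Y Z" by (simp add: lift_equivariant TU flip: Y)
  ultimately show ?thesis
    using lift_braid[of T V U] by (simp add: VU flip: U_def Y X)
qed

section \<open>The framing\<close>

lemma bd_self_act [simp]: "A \<in> carrier E \<Longrightarrow> bd (A \<rhd>\<^sub>E A) = bd A"
  by (simp add: bd_equivariant hom_bd.H.m_assoc)

text \<open>Either equation forces \<open>bd A = bd Z\<close>, so \<open>A\<close> and
  \<open>Z\<close> may replace each other as acting elements. Thus the maps
  \<open>A \<rhd> A\<close> and \<open>inv Z \<rhd> Z\<close> are mutually inverse.\<close>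

lemma self_act_eq_iff:
  assumes [simp]: "A \<in> carrier E" "Z \<in> carrier E"
  shows "A \<rhd>\<^sub>E A = Z \<longleftrightarrow> A = inv\<^bsub>E\<^esub> Z \<rhd>\<^sub>E Z"
proof
  show "A = inv\<^bsub>E\<^esub> Z \<rhd>\<^sub>E Z" if "A \<rhd>\<^sub>E A = Z"
  proof -
    have "bd Z = bd A" using that by auto
    then have "inv\<^bsub>E\<^esub> Z \<rhd>\<^sub>E Z = inv\<^bsub>E\<^esub> A \<rhd>\<^sub>E A \<rhd>\<^sub>E A" by (simp add: that hom_bd.hom_inv)
    then show ?thesis by simp
  qed
  show "A \<rhd>\<^sub>E A = Z" if A: "A = inv\<^bsub>E\<^esub> Z \<rhd>\<^sub>E Z"
  proof -
    have "bd A = bd Z" by (simp add: A bd_equivariant hom_bd.hom_inv)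
    then have "A \<rhd>\<^sub>E A = Z \<rhd>\<^sub>E inv\<^bsub>E\<^esub> Z \<rhd>\<^sub>E Z" by (simp flip: A)
    then show ?thesis by simp
  qed
qed

section \<open>Verification of the framed Reidemeister axioms\<close>

lemma framed_reidemeister_pair_lift:
  "framed_reidemeister_pair L E \<delta> (lifting_action L E \<delta> lift)
     (\<lambda>A B. lift A B) (\<lambda>A B. A \<rhd>' lift (inv\<^bsub>E\<^esub> A) B)"
proof -
  interpret lifting: crossed_module L E \<delta> "lifting_action L E \<delta> lift"
    by (rule crossed_module_lifting_action)
  let ?\<phi> = "\<lambda>A B. A \<rhd>' lift (inv\<^bsub>E\<^esub> A) B"
  have lifting_act_inv: "e \<rhd>' inv\<^bsub>L\<^esub> l = inv\<^bsub>L\<^esub> (e \<rhd>' l)" if "e \<in> carrier E" "l \<in> carrier L" for e l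
  proof -
    have "\<one>\<^bsub>L\<^esub> = e \<rhd>' \<one>\<^bsub>L\<^esub>" using that by (simp add: lifting_act_eq)
    then have "e \<rhd>' inv\<^bsub>L\<^esub> l \<otimes>\<^bsub>L\<^esub> e \<rhd>' l = \<one>\<^bsub>L\<^esub>" using that by (simp flip: lifting_act_mult)
    then show ?thesis using that by (simp add: hom_\<delta>.G.inv_equality)
  qed
  \<comment> \<open>The derived arcs \<open>Z\<close>, \<open>V\<close>, \<open>W\<close> of (R2)
    and (R3) all have this form.\<close>
  have crossing: "inv\<^bsub>E\<^esub> A \<otimes>\<^bsub>E\<^esub> inv\<^bsub>E\<^esub> (\<delta> (?\<phi> A B)) \<otimes>\<^bsub>E\<^esub> B \<otimes>\<^bsub>E\<^esub> A = inv\<^bsub>E\<^esub> A \<rhd>\<^sub>E B"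
    if "A \<in> carrier E" "B \<in> carrier E" for A B
    using that by (simp add: lifting_act_lift_inv \<delta>_lift_inv_boundary_act E_assoc)
  have \<phi>_eq_iff: "\<delta> (?\<phi> A Z) \<otimes>\<^bsub>E\<^esub> A = Z \<longleftrightarrow> A \<rhd>\<^sub>E A = Z"
    if [simp]: "A \<in> carrier E" "Z \<in> carrier E" for A Z
  proof -
    \<comment> \<open>Cancelling the leading \<open>Z\<close> reduces the framing equation to
      \<open>A = inv A \<rhd> Z\<close>; acting by \<open>A\<close> then gives
      \<open>A \<rhd> A = Z\<close>.\<close>
    have "\<delta> (?\<phi> A Z) \<otimes>\<^bsub>E\<^esub> A = Z \<otimes>\<^bsub>E\<^esub> (A \<otimes>\<^bsub>E\<^esub> inv\<^bsub>E\<^esub> (inv\<^bsub>E\<^esub> A \<rhd>\<^sub>E Z))"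
      by (simp add: lifting_act_lift_inv \<delta>_lift_inv_boundary_act E_assoc
          hom_\<delta>.H.inv_mult_group)
    then have "\<delta> (?\<phi> A Z) \<otimes>\<^bsub>E\<^esub> A = Z \<longleftrightarrow> A \<otimes>\<^bsub>E\<^esub> inv\<^bsub>E\<^esub> (inv\<^bsub>E\<^esub> A \<rhd>\<^sub>E Z) = \<one>\<^bsub>E\<^esub>"
      by simp
    also have "\<dots> \<longleftrightarrow> A = inv\<^bsub>E\<^esub> A \<rhd>\<^sub>E Z"
      using hom_\<delta>.H.inv_solve_right[of "\<one>\<^bsub>E\<^esub>" A "inv\<^bsub>E\<^esub> A \<rhd>\<^sub>E Z"]
      by auto
    also have "\<dots> \<longleftrightarrow> A \<rhd>\<^sub>E A = Z"
      by (metis boundary_act_inv_cancel that)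
    finally show ?thesis .
  qed
  \<comment> \<open>As an equivalence for arbitrary \<open>A\<close>, this yields both uniqueness
    and the value of the description in \<open>framing_f\<close>.\<close>
  have solution: "A \<in> carrier E \<and> \<delta> (?\<phi> A Z) \<otimes>\<^bsub>E\<^esub> A = Z \<longleftrightarrow> A = inv\<^bsub>E\<^esub> Z \<rhd>\<^sub>E Z"
    if "Z \<in> carrier E" for A Z
  proof (cases "A \<in> carrier E")
    case False
    then show ?thesis using that by auto
  qed (use that in \<open>simp add: \<phi>_eq_iff self_act_eq_iff\<close>)
  have f: "framing_f L E \<delta> ?\<phi> Z = inv\<^bsub>E\<^esub> Z \<rhd>\<^sub>E Z" if "Z \<in> carrier E" for Z
    using that by (simp add: framing_f_def solution)
  \<comment> \<open>Here \<open>\<delta> {A, A} = A inv (A \<rhd> A)\<close>, whose inverse times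
    \<open>A\<close> is \<open>A \<rhd> A\<close>.\<close>
  have g: "framing_g L E \<delta> (\<lambda>A B. lift A B) A = A \<rhd>\<^sub>E A" if "A \<in> carrier E" for A
    using that by (simp add: framing_g_def \<delta>_lift_eq E_assoc hom_\<delta>.H.inv_mult_group)
  show ?thesis
  proof
    show "(\<lambda>A B. lift A B) \<in> carrier E \<rightarrow> carrier E \<rightarrow> carrier L"
      and "?\<phi> \<in> carrier E \<rightarrow> carrier E \<rightarrow> carrier L"
      by simp_all
  next
    fix X Y Z
    assume "X \<in> carrier E" "Y \<in> carrier E"
      and Z: "Z = inv\<^bsub>E\<^esub> X \<otimes>\<^bsub>E\<^esub> inv\<^bsub>E\<^esub> (\<delta> (?\<phi> X Y)) \<otimes>\<^bsub>E\<^esub> Y \<otimes>\<^bsub>E\<^esub> X"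
    then show "?\<phi> X Y \<otimes>\<^bsub>L\<^esub> lift X Z = \<one>\<^bsub>L\<^esub>"
      by (simp only: crossing) (simp add: lifting_act_lift_inv)
  next
    fix X Y T Z V W
    assume [simp]: "X \<in> carrier E" "Y \<in> carrier E" "T \<in> carrier E"
      and Z': "Z = inv\<^bsub>E\<^esub> Y \<otimes>\<^bsub>E\<^esub> inv\<^bsub>E\<^esub> (\<delta> (?\<phi> Y X)) \<otimes>\<^bsub>E\<^esub> X \<otimes>\<^bsub>E\<^esub> Y"
      and V': "V = inv\<^bsub>E\<^esub> T \<otimes>\<^bsub>E\<^esub> inv\<^bsub>E\<^esub> (\<delta> (?\<phi> T Y)) \<otimes>\<^bsub>E\<^esub> Y \<otimes>\<^bsub>E\<^esub> T"
      and W': "W = inv\<^bsub>E\<^esub> T \<otimes>\<^bsub>E\<^esub> inv\<^bsub>E\<^esub> (\<delta> (?\<phi> T X)) \<otimes>\<^bsub>E\<^esub> X \<otimes>\<^bsub>E\<^esub> T"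
    have Z: "Z = inv\<^bsub>E\<^esub> Y \<rhd>\<^sub>E X" and V: "V = inv\<^bsub>E\<^esub> T \<rhd>\<^sub>E Y" and W: "W = inv\<^bsub>E\<^esub> T \<rhd>\<^sub>E X"
      unfolding Z' V' W' by (simp_all only: crossing \<open>X \<in> _\<close> \<open>Y \<in> _\<close> \<open>T \<in> _\<close>)
    have [simp]: "Z \<in> carrier E" "V \<in> carrier E" "W \<in> carrier E"
      by (simp_all add: Z V W)
    \<comment> \<open>Invert both sides of \<open>lift_R3\<close>; \<open>lifting_act_inv\<close>
      moves the inverses inside the second action.\<close>
    show "?\<phi> Y X \<otimes>\<^bsub>L\<^esub> Y \<rhd>' ?\<phi> T Z \<otimes>\<^bsub>L\<^esub> ?\<phi> T Y = X \<rhd>' ?\<phi> T Y \<otimes>\<^bsub>L\<^esub> ?\<phi> T X \<otimes>\<^bsub>L\<^esub> T \<rhd>' ?\<phi> V W"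
      using arg_cong[OF lift_R3[of T X Y, folded Z V W], of "m_inv L"]
      by (simp add: lifting_act_lift_inv lifting_act_inv hom_\<delta>.G.inv_mult_group L_assoc flip: Z V W)
  next
    fix Z assume "Z \<in> carrier E"
    then show "\<exists>!A. A \<in> carrier E \<and> \<delta> (?\<phi> A Z) \<otimes>\<^bsub>E\<^esub> A = Z"
      by (simp only: solution) simp
  next
    fix A assume A: "A \<in> carrier E"
    then show "framing_f L E \<delta> ?\<phi> (framing_g L E \<delta> (\<lambda>A B. lift A B) A) = A"
      by (metis f g self_act_eq_iff actE_simps(1) hom_bd.hom_closed)
    show "framing_g L E \<delta> (\<lambda>A B. lift A B) (framing_f L E \<delta> ?\<phi> A) = A"
      using A by (metis f g self_act_eq_iff actE_simps(1) hom_bd.hom_closed hom_\<delta>.H.inv_closed)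
  qed
qed

end

theorem theorem4p18:
  fixes L :: "('l, 'x) monoid_scheme" and E :: "('e, 'y) monoid_scheme"
    and G :: "('g, 'z) monoid_scheme"
    and \<delta> :: "'l \<Rightarrow> 'e" and bd :: "'e \<Rightarrow> 'g"
    and actL :: "'g \<Rightarrow> 'l \<Rightarrow> 'l" and actE :: "'g \<Rightarrow> 'e \<Rightarrow> 'e"
    and lift :: "'e \<Rightarrow> 'e \<Rightarrow> 'l"
  assumes "two_crossed_module L E G \<delta> bd actL actE lift"
    and "finite (carrier E)"
  shows "framed_reidemeister_pair L E \<delta> (lifting_action L E \<delta> lift)
           (\<lambda>A B. lift A B)
           (\<lambda>A B. lifting_action L E \<delta> lift A (lift (inv\<^bsub>E\<^esub> A) B))"
  using assms(1) by (rule two_crossed_module.framed_reidemeister_pair_lift)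

end
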